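(* Let $T$ be an infinite, locally finite tree and let $k$ be a positive integer. If $\mathrm{br}(T)<k$, then $p(T,k)=1$.
   Context: Bootstrap percolation with the $k$-neighbor rule ($k$-rule) on a countable, connected, locally finite graph $G=(V,E)$: initially each vertex is occupied with probability $p$ and vacant with probability $1-p$, independently of each other (law $\mathbb{P}_p$). Then a deterministic rule is iterated in discrete time: if a vacant vertex has at least $k$ occupied neighbors at some time step, it becomes occupied in the next step; occupied vertices remain occupied. Complete occupation is the event that every vertex eventually becomes occupied. For an infinite graph $G$, the critical probability is $p(G,k)=\inf\{p\in[0,1] : \mathbb{P}_p(\text{complete occupation})>0\}$. Branching number: for an infinite locally finite tree $T$ with a chosen root, $\mathrm{br}(T)$ is the supremum of the real numbers $\lambda\ge 1$ such that $T$ admits a flow of positive strength from the root to infinity in which the flow through each edge $e$ is at most $\lambda^{-|e|}$, where $|e|$ is the number of edges (including $e$) on the path from $e$ to the root. This does not depend on the choice of the root. *)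

theory Defs
  imports "HOL-Probability.Probability" "Graph_Theory.Digraph_Component"
begin

text \<open>
  An undirected simple graph is a symmetric, loop-free pair digraph
  (\<open>pair_bidirected_digraph\<close>): every undirected edge is a pair of opposite arcs.
\<close>

definition neighbors :: "'a pair_pre_digraph \<Rightarrow> 'a \<Rightarrow> 'a set" where
  "neighbors G v = {w. (v, w) \<in> parcs G}"

definition locally_finite :: "'a pair_pre_digraph \<Rightarrow> bool" where
  "locally_finite G \<longleftrightarrow> (\<forall>v \<in> pverts G. finite (neighbors G v))"

text \<open>
  The library's \<open>tree\<close> forbids all directed cycles, so it is false of any symmetric
  digraph with an arc (traverse an edge back and forth). In a loop-free symmetric pair
  digraph, the cycles of the underlying undirected graph are exactly the directed cycles
  of length at least 3.
\<close>

definition undirected_tree :: "'a pair_pre_digraph \<Rightarrow> bool" where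
  "undirected_tree T \<longleftrightarrow>
     pair_bidirected_digraph T \<and>
     Digraph_Component.connected (with_proj T) \<and>
     \<not> (\<exists>c. pre_digraph.cycle (with_proj T) c \<and> 3 \<le> length c)"


subsection \<open>Bootstrap percolation\<close>

text \<open>
  \<open>occupied G k A n\<close> is the set of vertices occupied at time \<open>n\<close> under the \<open>k\<close>-neighbor
  rule, if exactly those in \<open>A\<close> are occupied at time 0. It is meant for locally finite
  \<open>G\<close>, since \<open>card\<close> of an infinite set is 0.
\<close>

primrec occupied :: "'a pair_pre_digraph \<Rightarrow> nat \<Rightarrow> 'a set \<Rightarrow> nat \<Rightarrow> 'a set" where
  "occupied G k A 0 = A"
| "occupied G k A (Suc n) =
     occupied G k A n \<union>
     {v \<in> pverts G. k \<le> card (neighbors G v \<inter> occupied G k A n)}"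

definition complete_occupation :: "'a pair_pre_digraph \<Rightarrow> nat \<Rightarrow> 'a set \<Rightarrow> bool" where
  "complete_occupation G k A \<longleftrightarrow> (\<forall>v \<in> pverts G. \<exists>n. v \<in> occupied G k A n)"

definition config_measure :: "'a pair_pre_digraph \<Rightarrow> real \<Rightarrow> ('a \<Rightarrow> bool) measure" where
  "config_measure G p = (\<Pi>\<^sub>M v \<in> pverts G. measure_pmf (bernoulli_pmf p))"

definition critical_probability :: "'a pair_pre_digraph \<Rightarrow> nat \<Rightarrow> real" where
  "critical_probability G k =
     Inf {p \<in> {0..1}.
       0 < measure (config_measure G p)
             {\<omega> \<in> space (config_measure G p).
                complete_occupation G k {v \<in> pverts G. \<omega> v}}}"


subsection \<open>Branching number\<close>

definition depth :: "'a pair_pre_digraph \<Rightarrow> 'a \<Rightarrow> 'a \<Rightarrow> nat" where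
  "depth T r v = length (THE c. pre_digraph.apath (with_proj T) r c v)"

definition children :: "'a pair_pre_digraph \<Rightarrow> 'a \<Rightarrow> 'a \<Rightarrow> 'a set" where
  "children T r u = {v \<in> neighbors T u. depth T r v = Suc (depth T r u)}"

text \<open>
  A flow from the root \<open>r\<close> to infinity runs away from the root and is conserved at every
  other vertex; only its values on arcs \<open>(u, v)\<close> with \<open>v\<close> a child of \<open>u\<close> matter.
  Such an edge has \<open>|e| = depth T r v\<close>.
\<close>

definition is_flow :: "'a pair_pre_digraph \<Rightarrow> 'a \<Rightarrow> ('a \<times> 'a \<Rightarrow> real) \<Rightarrow> bool" where
  "is_flow T r \<theta> \<longleftrightarrow>
     (\<forall>u \<in> pverts T. \<forall>v \<in> children T r u.
        0 \<le> \<theta> (u, v) \<and> \<theta> (u, v) = (\<Sum>w \<in> children T r v. \<theta> (v, w)))"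

definition flow_strength :: "'a pair_pre_digraph \<Rightarrow> 'a \<Rightarrow> ('a \<times> 'a \<Rightarrow> real) \<Rightarrow> real" where
  "flow_strength T r \<theta> = (\<Sum>v \<in> children T r r. \<theta> (r, v))"

definition admits_flow :: "'a pair_pre_digraph \<Rightarrow> 'a \<Rightarrow> real \<Rightarrow> bool" where
  "admits_flow T r lam \<longleftrightarrow>
     (\<exists>\<theta>. is_flow T r \<theta> \<and> 0 < flow_strength T r \<theta> \<and>
        (\<forall>u \<in> pverts T. \<forall>v \<in> children T r u. \<theta> (u, v) \<le> (1 / lam) ^ depth T r v))"

text \<open>The supremum is taken in the extended reals: it may be infinite.\<close>

definition branching_number :: "'a pair_pre_digraph \<Rightarrow> 'a \<Rightarrow> ereal" where
  "branching_number T r = Sup (ereal ` {lam. 1 \<le> lam \<and> admits_flow T r lam})"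

end

theory Submission
  imports Defs
begin

text \<open>
  Fix \<open>p < 1\<close>. Complete occupation fails as soon as some vacant set \<open>F\<close> is a fort, that is, each
  vertex of \<open>F\<close> has fewer than \<open>k\<close> neighbors outside \<open>F\<close>. If the tree contains infinitely many
  disjoint forts of bounded size, then almost surely one of them is vacant, and complete
  occupation has probability 0. What remains is a statement about the tree alone: without such
  forts, the branching number is at least \<open>k\<close>.

  The forts in use are of a simple kind. A vertex with fewer than \<open>k\<close> children has a deficit
  compared with the tree in which every vertex has \<open>k\<close> children and whose branching number is
  \<open>k\<close>. On a descending path through vertices with exactly \<open>k\<close> children to a vertex with a
  deficit, every vertex meets the condition on a fort, provided that the parent of the first one
  is included in the set. So a vertex with fewer than \<open>2 * k\<close> children, of which at most \<open>k - 2\<close>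
  do not head such a path with at most \<open>N\<close> vertices, is the top of a fort with at most
  \<open>1 + 2 * k * N\<close> vertices (\<open>fort_top\<close>).

  Suppose that for each \<open>N\<close> there are only finitely many such tops. Then for every \<open>lam\<close> with
  \<open>1 \<le> lam < k\<close> there is a flow bounded by \<open>lam ^ (- |e|)\<close>. It comes from a bounded nonnegative
  function \<open>f\<close> with \<open>lam * f x \<le> (\<Sum>y. f y)\<close>, the sum over the children of \<open>x\<close>: sending the mass
  at \<open>x\<close> to its children in proportion to \<open>f\<close> obeys the bound (\<open>admits_flow_of_subharmonic\<close>). A
  function that satisfies the inequality below some level can be continued to the root
  (\<open>admits_flow_of_eventually_subharmonic\<close>). Far from the root there are no tops, and \<open>f\<close> can be
  read off from the distance to the nearest deficit along the paths: it is \<open>1 / 2\<close> at a deficit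
  and rises slowly to 1 (\<open>admits_flow_of_finite_fort_tops\<close>). For \<open>lam\<close> above the branching
  number this is a contradiction. The case \<open>k = 1\<close> does not occur, because an infinite locally
  finite tree contains a ray and has branching number at least 1.
\<close>

section \<open>Rooted trees\<close>

locale undirected_rooted_tree =
  fixes T :: "'a pair_pre_digraph" and r :: 'a
  assumes tree: "undirected_tree T"
    and root: "r \<in> pverts T"

sublocale undirected_rooted_tree \<subseteq> pair_bidirected_digraph T
  using tree by (simp add: undirected_tree_def)

context undirected_rooted_tree
begin

lemma no_long_cycle: "cycle c \<Longrightarrow> length c < 3"
  using tree unfolding undirected_tree_def by (meson not_less)

text \<open>
  If two paths leave \<open>u\<close> by different arcs to \<open>a\<close> and \<open>b\<close> and meet again in \<open>v\<close>, then following
  the first and coming back along the second gives a walk from \<open>a\<close> to \<open>b\<close> that avoids \<open>u\<close>.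
  Shortened to a path, it closes up through \<open>u\<close> to a cycle, of length at least 3 because
  \<open>a \<noteq> b\<close>.
\<close>

lemma apath_unique: "apath u p v \<Longrightarrow> apath u q v \<Longrightarrow> p = q"
proof (induction p arbitrary: u q)
  case Nil
  then show ?case using apath_ends by blast
next
  case (Cons e p)
  obtain f q' where q: "q = f # q'"
    using Cons.prems apath_ends by (metis list.exhaust list.distinct(1))
  define a b where "a = snd e" and "b = snd f"
  have e: "e = (u, a)" "e \<in> parcs T" "apath a p v" "u \<notin> set (pawalk_verts a p)"
    and f: "f = (u, b)" "f \<in> parcs T" "apath b q' v" "u \<notin> set (pawalk_verts b q')"
    using Cons.prems by (auto simp: q a_def b_def apath_Cons_iff prod_eq_iff)
  show ?case
  proof (cases "a = b")
    case True
    then show ?thesis using Cons.IH e f q by auto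
  next
    case False
    define w where "w = p @ rev_path q'"
    have rq: "awalk v (rev_path q') b"
      using f(3) awalk_rev_path' awalkI_apath by blast
    then have w: "awalk a w b"
      unfolding w_def using e(3) awalkI_apath awalk_appendI by blast
    have "set (pawalk_verts a w) = set (pawalk_verts a p) \<union> set (pawalk_verts v (rev_path q'))"
      unfolding w_def using set_awalk_verts_append[OF awalkI_apath[OF e(3)] rq] by simp
    also have "set (pawalk_verts v (rev_path q')) = set (pawalk_verts b q')"
      using awalk_verts_rev_path[OF awalkI_apath[OF f(3)]] by simp
    finally have uw: "u \<notin> set (pawalk_verts a w)" using e f by auto
    define s where "s = awalk_to_apath w"
    have s: "apath a s b" unfolding s_def using w by (rule apath_awalk_to_apath)
    have "set s \<subseteq> set w" unfolding s_def using w by (rule awalk_to_apath_subset)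
    then have "set (pawalk_verts a s) \<subseteq> set (pawalk_verts a w)"
      using set_awalk_verts[OF awalkI_apath[OF s]] set_awalk_verts[OF w] by auto
    then have us: "u \<notin> set (pawalk_verts a s)" using uw by auto
    have "s \<noteq> []" using s False by (auto simp: apath_Nil_iff)
    have bu: "(b, u) \<in> parcs T" using f pair_sym_arcs
      by (metis arcs_symmetric)
    have bv: "b \<in> pverts T" "u \<in> pverts T" using bu in_arcsD1 in_arcsD2 by auto
    have aw: "awalk a (s @ [(b, u)]) u"
      using awalkI_apath[OF s] bu bv by (auto simp: awalk_simps)
    have "pawalk_verts a (s @ [(b, u)]) = pawalk_verts a s @ [u]"
      using awalk_verts_append[OF aw] awalkI_apath[OF s] by simp
    then have "cycle (e # s @ [(b, u)])"
      unfolding cycle_def using aw e us s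
      by (intro exI[of _ u]) (auto simp: awalk_simps apath_def bv)
    then have "length (e # s @ [(b, u)]) < 3" by (rule no_long_cycle)
    with \<open>s \<noteq> []\<close> show ?thesis by (cases s) auto
  qed
qed

lemma apath_exists: "v \<in> pverts T \<Longrightarrow> \<exists>p. apath r p v"
proof -
  assume "v \<in> pverts T"
  moreover have "strongly_connected (with_proj T)"
    using symmetric_connected_imp_strongly_connected tree pair_sym_arcs
    unfolding undirected_tree_def by simp
  ultimately have "r \<rightarrow>\<^sup>*\<^bsub>with_proj T\<^esub> v" using root by auto
  then show ?thesis using reachable_apath by blast
qed

lemma depth_eq: "apath r p v \<Longrightarrow> depth T r v = length p"
  unfolding depth_def using apath_unique by (metis the_equality)

lemma depth_root: "depth T r r = 0"
  using depth_eq[of "[]" r] root by (simp add: apath_Nil_iff)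

lemma depth_0_iff: "v \<in> pverts T \<Longrightarrow> depth T r v = 0 \<longleftrightarrow> v = r"
  using apath_exists[of v] depth_eq depth_root by (auto simp: apath_Nil_iff)

lemma neighbors_in_verts: "w \<in> neighbors T v \<Longrightarrow> w \<in> pverts T \<and> v \<in> pverts T"
  unfolding neighbors_def using in_arcsD1 in_arcsD2 by auto

lemma neighbors_sym: "w \<in> neighbors T v \<longleftrightarrow> v \<in> neighbors T w"
  unfolding neighbors_def using arcs_symmetric by auto

lemma apath_snoc:
  assumes "apath r p v" "w \<in> neighbors T v" "w \<notin> set (pawalk_verts r p)"
  shows "apath r (p @ [(v, w)]) w"
proof -
  have aw: "awalk r (p @ [(v, w)]) w"
    using awalkI_apath[OF assms(1)] assms(2) neighbors_in_verts[OF assms(2)]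
    by (auto simp: awalk_simps neighbors_def)
  have "pawalk_verts r (p @ [(v, w)]) = pawalk_verts r p @ [w]"
    using awalk_verts_append[OF aw] awalkI_apath[OF assms(1)] by simp
  then show ?thesis using aw assms by (auto simp: apath_def)
qed

lemma apath_last_arc:
  assumes "v \<in> pverts T" "v \<noteq> r"
  shows "\<exists>u p. apath r p u \<and> apath r (p @ [(u, v)]) v \<and> v \<in> neighbors T u"
proof -
  obtain q where q: "apath r q v" using apath_exists assms by blast
  then have "q \<noteq> []" using assms by (auto simp: apath_Nil_iff)
  then obtain p u w where pe: "q = p @ [(u, w)]" by (metis rev_exhaust surj_pair)
  have "apath r (p @ [(u, w)]) v" using q pe by simp
  moreover from this have "apath r p u" "w = v" "(u, v) \<in> parcs T"
    by (auto simp: apath_append_iff apath_simps)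
  ultimately show ?thesis unfolding neighbors_def by auto
qed

lemma has_parent:
  assumes "v \<in> pverts T" "v \<noteq> r"
  shows "\<exists>u \<in> pverts T. v \<in> children T r u"
  using apath_last_arc[OF assms] depth_eq neighbors_in_verts unfolding children_def by force

text \<open>
  A path from the root to \<open>v\<close> that arrives from \<open>u\<close> can be prolonged to any neighbor \<open>w \<noteq> u\<close>: if
  \<open>w\<close> lay on the path already, its final stretch from \<open>w\<close> to \<open>v\<close> and the single arc \<open>(w, v)\<close>
  would be two paths from \<open>w\<close> to \<open>v\<close>.
\<close>

lemma nonparent_is_child:
  assumes "apath r p u" "apath r (p @ [(u, v)]) v" "w \<in> neighbors T v" "w \<noteq> u"
  shows "w \<in> children T r v"
proof -
  have "w \<notin> set (pawalk_verts r (p @ [(u, v)]))"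
  proof
    assume "w \<in> set (pawalk_verts r (p @ [(u, v)]))"
    then obtain q s where qs: "p @ [(u, v)] = q @ s" "awalk r q w" "awalk w s v"
      using awalk_decomp awalkI_apath[OF assms(2)] by blast
    have wv: "w \<noteq> v" using assms(3) pair_no_loops unfolding neighbors_def by fastforce
    have "apath r (q @ s) v" using assms(2) qs(1) by simp
    then have s: "apath w s v" using qs(2) unfolding apath_append_iff by simp
    have "apath w [(w, v)] v"
      using assms(3) wv neighbors_in_verts[OF assms(3)] neighbors_sym[of w v]
      by (auto simp: apath_simps neighbors_def)
    with s have "s = [(w, v)]" by (rule apath_unique)
    then show False using qs(1) assms(4) by simp
  qed
  from apath_snoc[OF assms(2,3) this] have "depth T r w = Suc (length (p @ [(u, v)]))"
    using depth_eq by fastforce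
  moreover have "depth T r v = length (p @ [(u, v)])" using depth_eq assms(2) by blast
  ultimately show ?thesis using assms(3) by (simp add: children_def)
qed

lemma neighbors_child:
  assumes "v \<in> children T r u"
  shows "neighbors T v \<subseteq> insert u (children T r v)"
proof -
  have v: "v \<in> pverts T" "u \<in> neighbors T v" "v \<noteq> r"
    using assms neighbors_in_verts neighbors_sym depth_root by (auto simp: children_def)
  obtain u' p where p: "apath r p u'" "apath r (p @ [(u', v)]) v"
    using apath_last_arc v by blast
  have "u = u'"
  proof (rule ccontr)
    assume "u \<noteq> u'"
    from nonparent_is_child[OF p v(2) this] show False
      using assms by (auto simp: children_def)
  qed
  then show ?thesis using nonparent_is_child[OF p] by blast
qed

lemma neighbors_root: "neighbors T r \<subseteq> children T r r"
proof
  fix w assume w: "w \<in> neighbors T r"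
  then have "w \<noteq> r" using pair_no_loops unfolding neighbors_def by fastforce
  have "apath r [(r, w)] w" using w \<open>w \<noteq> r\<close> root neighbors_in_verts[OF w]
    by (auto simp: apath_simps neighbors_def)
  from depth_eq[OF this] show "w \<in> children T r r"
    using w depth_root by (simp add: children_def)
qed

lemma parent_unique:
  assumes "v \<in> children T r u" "v \<in> children T r u'"
  shows "u = u'"
proof -
  have "u' \<in> neighbors T v" using assms(2) neighbors_sym by (auto simp: children_def)
  then show ?thesis using neighbors_child[OF assms(1)] assms by (auto simp: children_def)
qed

lemma children_subset_verts: "v \<in> children T r u \<Longrightarrow> v \<in> pverts T \<and> u \<in> pverts T"
  using neighbors_in_verts by (auto simp: children_def)

end

locale locally_finite_rooted_tree = undirected_rooted_tree +
  assumes locally_finite: "locally_finite T"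
begin

lemma finite_neighbors: "finite (neighbors T v)"
proof (cases "v \<in> pverts T")
  case False
  then have "neighbors T v = {}" using neighbors_in_verts by auto
  then show ?thesis by simp
qed (use locally_finite in \<open>simp add: locally_finite_def\<close>)

lemma finite_children: "finite (children T r v)"
  using finite_neighbors by (simp add: children_def)

lemma finite_level: "finite {v \<in> pverts T. depth T r v = n}"
proof (induction n)
  case 0
  have "{v \<in> pverts T. depth T r v = 0} \<subseteq> {r}" using depth_0_iff by auto
  then show ?case using finite_subset by blast
next
  case (Suc n)
  have "{v \<in> pverts T. depth T r v = Suc n}
      \<subseteq> (\<Union>u \<in> {u \<in> pverts T. depth T r u = n}. children T r u)"
  proof
    fix v assume "v \<in> {v \<in> pverts T. depth T r v = Suc n}"
    then have v: "v \<in> pverts T" "depth T r v = Suc n" by auto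
    then obtain u where "u \<in> pverts T" "v \<in> children T r u"
      using has_parent depth_root by force
    then show "v \<in> (\<Union>u \<in> {u \<in> pverts T. depth T r u = n}. children T r u)"
      using v by (auto simp: children_def)
  qed
  then show ?case using Suc finite_children by (meson finite_UN finite_subset)
qed

lemma finite_levels_below: "finite {v \<in> pverts T. depth T r v < n}"
proof -
  have "{v \<in> pverts T. depth T r v < n} = (\<Union>i<n. {v \<in> pverts T. depth T r v = i})" by auto
  then show ?thesis using finite_level by simp
qed

lemma countable_verts: "countable (pverts T)"
proof -
  have "pverts T = (\<Union>n. {v \<in> pverts T. depth T r v = n})" by auto
  then show ?thesis
    using finite_level countable_finite by (metis (lifting) countable_UN countableI_type)
qed

lemma infinite_imp_unbounded_depth:
  assumes "infinite X" "X \<subseteq> pverts T"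
  shows "\<exists>x \<in> X. n \<le> depth T r x"
proof (rule ccontr)
  assume "\<not> ?thesis"
  then have "X \<subseteq> {v \<in> pverts T. depth T r v < n}" using assms(2) by force
  then show False using assms(1) finite_levels_below finite_subset by blast
qed

lemma level_nonempty:
  assumes "infinite (pverts T)"
  shows "\<exists>x \<in> pverts T. depth T r x = n"
proof -
  have "\<exists>x \<in> pverts T. depth T r x = n" if "v \<in> pverts T" "depth T r v = n + m" for v m
    using that
  proof (induction m arbitrary: v)
    case (Suc m)
    then obtain u where "u \<in> pverts T" "v \<in> children T r u"
      using has_parent depth_root by force
    then show ?case using Suc by (auto simp: children_def)
  qed auto
  moreover obtain v where "v \<in> pverts T" "n \<le> depth T r v"
    using infinite_imp_unbounded_depth[OF assms, of n] by blast
  ultimately show ?thesis by (metis le_add_diff_inverse)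
qed

end

section \<open>Flows from subharmonic functions\<close>

context locally_finite_rooted_tree
begin

text \<open>
  Start with mass \<open>f r\<close> at the root and let every vertex divide its mass among its children in
  proportion to \<open>f\<close>. Subharmonicity keeps the mass at \<open>x\<close> below \<open>f x * (1 / lam) ^ |x|\<close> from one
  level to the next.
\<close>

lemma admits_flow_of_subharmonic:
  fixes f :: "'a \<Rightarrow> real"
  assumes lam: "0 < lam"
    and f: "\<And>x. x \<in> pverts T \<Longrightarrow> 0 \<le> f x" "\<And>x. x \<in> pverts T \<Longrightarrow> f x \<le> 1"
    and sub: "\<And>x. x \<in> pverts T \<Longrightarrow> lam * f x \<le> (\<Sum>y\<in>children T r x. f y)"
    and pos: "0 < f r"
  shows "admits_flow T r lam"
proof -
  \<comment> \<open>At a vertex with \<open>S x = 0\<close> the division by zero gives the children mass 0,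
    which is right because \<open>f x\<close>, and with it the mass at \<open>x\<close>, is then 0 as well.\<close>
  define S where "S x = (\<Sum>y\<in>children T r x. f y)" for x
  define parent where "parent y = (THE x. y \<in> children T r x)" for y
  have parent: "parent y = x" if "y \<in> children T r x" for x y
    unfolding parent_def using that parent_unique by blast
  define mass_at where
    "mass_at = rec_nat (\<lambda>_. f r) (\<lambda>_ g y. g (parent y) * (f y / S (parent y)))"
  define mass where "mass x = mass_at (depth T r x) x" for x
  have mass_root: "mass r = f r" by (simp add: mass_def mass_at_def depth_root)
  have mass_child: "mass y = mass x * (f y / S x)" if "y \<in> children T r x" for x y
    using that parent[OF that] by (simp add: mass_def mass_at_def children_def)
  have bound: "0 \<le> mass x \<and> mass x \<le> f x * (1 / lam) ^ depth T r x" if "x \<in> pverts T" for x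
    using that
  proof (induction "depth T r x" arbitrary: x)
    case 0
    then have "x = r" using depth_0_iff by auto
    then show ?case using pos by (simp add: mass_root depth_root)
  next
    case (Suc n y)
    then obtain x where x: "x \<in> pverts T" "y \<in> children T r x"
      using has_parent depth_root by force
    then have n: "n = depth T r x" using Suc by (simp add: children_def)
    have mx: "0 \<le> mass x" "mass x \<le> f x * (1 / lam) ^ n" using Suc.hyps(1)[OF n x(1)] n by auto
    have S: "lam * f x \<le> S x" using sub x by (simp add: S_def)
    have S0: "0 \<le> S x" unfolding S_def using f children_subset_verts by (intro sum_nonneg) blast
    have fy: "0 \<le> f y" using f Suc.prems by auto
    show ?case
    proof (cases "S x = 0")
      case True
      then show ?thesis using mass_child[OF x(2)] fy lam by simp
    next
      case False
      have "mass x \<le> (S x / lam) * (1 / lam) ^ n"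
        using mx(2) S lam by (elim order_trans) (auto intro!: mult_right_mono simp: field_simps)
      then have "mass x * (f y / S x) \<le> (S x / lam) * (1 / lam) ^ n * (f y / S x)"
        using fy S0 by (intro mult_right_mono) auto
      also have "\<dots> = f y * (1 / lam) ^ Suc n" using False by simp
      finally show ?thesis
        using mass_child[OF x(2)] mx fy S0 Suc.hyps(2) by simp
    qed
  qed
  have conserved: "(\<Sum>y\<in>children T r x. mass y) = mass x" if "x \<in> pverts T" for x
  proof -
    have "(\<Sum>y\<in>children T r x. mass y) = (\<Sum>y\<in>children T r x. mass x * (f y / S x))"
      using mass_child by (intro sum.cong) auto
    also have "\<dots> = mass x * (S x / S x)"
      unfolding S_def by (simp only: sum_distrib_left sum_divide_distrib)
    finally have "(\<Sum>y\<in>children T r x. mass y) = mass x * (S x / S x)" .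
    moreover have "mass x = 0" if "S x = 0"
    proof -
      have "f x = 0"
        using that sub[OF \<open>x \<in> pverts T\<close>] f(1)[OF \<open>x \<in> pverts T\<close>] lam
        by (simp add: S_def mult_le_0_iff)
      then show ?thesis using bound[OF \<open>x \<in> pverts T\<close>] by simp
    qed
    ultimately show ?thesis by (cases "S x = 0") auto
  qed
  define \<theta> where "\<theta> e = mass (snd e)" for e :: "'a \<times> 'a"
  have "is_flow T r \<theta>"
    unfolding is_flow_def \<theta>_def using bound conserved children_subset_verts by auto
  moreover have "0 < flow_strength T r \<theta>"
    using pos conserved[OF root] by (simp add: flow_strength_def \<theta>_def mass_root)
  moreover have "\<theta> (u, v) \<le> (1 / lam) ^ depth T r v" if "v \<in> children T r u" for u v
  proof -
    have v: "v \<in> pverts T" using that children_subset_verts by auto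
    have "mass v \<le> f v * (1 / lam) ^ depth T r v" using bound v by auto
    also have "\<dots> \<le> 1 * (1 / lam) ^ depth T r v"
      using f v lam by (intro mult_right_mono) auto
    finally show ?thesis by (simp add: \<theta>_def)
  qed
  ultimately show ?thesis unfolding admits_flow_def by blast
qed

text \<open>
  A function that is subharmonic from level \<open>Suc L\<close> on becomes subharmonic from level \<open>L\<close> on if
  its values on that level are discarded and only the parent \<open>a\<close> of the chosen vertex \<open>z\<close> gets a
  positive value, small enough to be paid for by \<open>z\<close> alone. Repeated up to the root, this
  reduces the claim to the previous lemma.
\<close>

lemma admits_flow_of_eventually_subharmonic:
  fixes f :: "'a \<Rightarrow> real"
  assumes lam: "1 \<le> lam"
    and f: "\<And>x. x \<in> pverts T \<Longrightarrow> 0 \<le> f x" "\<And>x. x \<in> pverts T \<Longrightarrow> f x \<le> 1"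
    and sub: "\<And>x. x \<in> pverts T \<Longrightarrow> L \<le> depth T r x \<Longrightarrow> lam * f x \<le> (\<Sum>y\<in>children T r x. f y)"
    and z: "z \<in> pverts T" "depth T r z = L" "0 < f z"
  shows "admits_flow T r lam"
  using f sub z
proof (induction L arbitrary: f z)
  case 0
  then show ?case
    using lam depth_0_iff by (intro admits_flow_of_subharmonic[of lam f]) auto
next
  case (Suc L)
  obtain a where a: "a \<in> pverts T" "z \<in> children T r a"
    using has_parent depth_root Suc.prems by force
  define g where "g x = (if depth T r x = L then if x = a then f z / lam else 0 else f x)" for x
  have da: "depth T r a = L" using a Suc.prems by (simp add: children_def)
  have g_children: "(\<Sum>y\<in>children T r x. g y) = (\<Sum>y\<in>children T r x. f y)" if "L \<le> depth T r x" for x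
    using that by (intro sum.cong) (auto simp: g_def children_def)
  show ?case
  proof (rule Suc.IH)
    show "0 \<le> g x" if "x \<in> pverts T" for x using that Suc.prems lam by (simp add: g_def)
    have "f z / lam \<le> 1" using Suc.prems(2)[OF Suc.prems(4)] lam by (simp add: divide_le_eq)
    then show "g x \<le> 1" if "x \<in> pverts T" for x using that Suc.prems by (simp add: g_def)
    show "a \<in> pverts T" "depth T r a = L" "0 < g a"
      using a da Suc.prems lam by (auto simp: g_def)
    show "lam * g x \<le> (\<Sum>y\<in>children T r x. g y)" if x: "x \<in> pverts T" "L \<le> depth T r x" for x
    proof -
      have nonneg: "0 \<le> f y" if "y \<in> children T r x" for y
        using that Suc.prems(1) children_subset_verts by blast
      consider "x = a" | "x \<noteq> a" "depth T r x = L" | "Suc L \<le> depth T r x" using x by linarith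
      then show ?thesis
      proof cases
        case 1
        have "f z \<le> (\<Sum>y\<in>children T r a. f y)"
          using a nonneg finite_children 1 by (intro member_le_sum) auto
        then show ?thesis using 1 da g_children[OF x(2)] lam by (simp add: g_def)
      next
        case 2
        then show ?thesis using g_children[OF x(2)] nonneg by (simp add: g_def sum_nonneg)
      next
        case 3
        then show ?thesis using g_children[OF x(2)] Suc.prems(3)[OF x(1)] by (simp add: g_def)
      qed
    qed
  qed
qed

primrec reaches_down :: "nat \<Rightarrow> 'a \<Rightarrow> bool" where
  "reaches_down 0 x = True"
| "reaches_down (Suc n) x = (\<exists>y \<in> children T r x. reaches_down n y)"

lemma reaches_down_decreasing: "reaches_down (Suc n) x \<Longrightarrow> reaches_down n x"
  by (induction n arbitrary: x) auto

text \<open>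
  The indicator function of the vertices with arbitrarily long descending paths is subharmonic
  for \<open>lam = 1\<close>: among finitely many children one has this property again (Koenig's lemma). The
  branching number is therefore at least 1, which excludes \<open>k = 1\<close> from the theorem.
\<close>

lemma admits_flow_1:
  assumes "infinite (pverts T)"
  shows "admits_flow T r 1"
proof (rule admits_flow_of_subharmonic)
  define f :: "'a \<Rightarrow> real" where "f x = (if \<forall>n. reaches_down n x then 1 else 0)" for x
  have anti: "reaches_down m x" if "reaches_down n x" "m \<le> n" for m n x
    using that(2,1) by (induction rule: dec_induct) (auto dest: reaches_down_decreasing simp del: reaches_down.simps)
  show "0 \<le> f x" "f x \<le> 1" for x by (auto simp: f_def)
  show "1 * f x \<le> (\<Sum>y\<in>children T r x. f y)" for x
  proof (cases "\<forall>n. reaches_down n x")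
    case True
    have "\<exists>y \<in> children T r x. \<forall>n. reaches_down n y"
    proof (rule ccontr)
      assume "\<not> ?thesis"
      then obtain n where n: "\<And>y. y \<in> children T r x \<Longrightarrow> \<not> reaches_down (n y) y" by metis
      define m where "m = Max (n ` children T r x)"
      obtain y where y: "y \<in> children T r x" "reaches_down m y"
        using True[rule_format, of "Suc m"] by auto
      have "n y \<le> m" unfolding m_def using y finite_children by auto
      then show False using n y anti by blast
    qed
    then obtain y where y: "y \<in> children T r x" "\<forall>n. reaches_down n y" by blast
    have "f y \<le> (\<Sum>y\<in>children T r x. f y)"
      using y finite_children by (intro member_le_sum) (auto simp: f_def)
    then show ?thesis using y True by (simp add: f_def)
  qed (auto simp: f_def intro!: sum_nonneg)
  have "\<exists>u \<in> pverts T. depth T r u = n \<and> reaches_down m u"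
    if "v \<in> pverts T" "depth T r v = n + m" for v n m
    using that
  proof (induction m arbitrary: n)
    case (Suc m)
    then obtain u where u: "u \<in> pverts T" "depth T r u = Suc n" "reaches_down m u"
      using Suc.IH[of "Suc n"] by auto
    then obtain w where "w \<in> pverts T" "u \<in> children T r w"
      using has_parent depth_root by force
    then show ?case using u by (auto simp: children_def intro!: bexI[of _ w])
  qed auto
  then have "reaches_down m r" for m
    using level_nonempty[OF assms, of m] depth_0_iff by (metis add_0)
  then show "0 < f r" by (simp add: f_def)
qed simp

end

section \<open>Forts\<close>

text \<open>
  These sets are the \<open>(k - 1)\<close>-forts of bootstrap percolation: each of their vertices sees fewer
  than \<open>k\<close> vertices outside, so no vertex of an entirely vacant one can be the first to become
  occupied.
\<close>

definition blocking :: "'a pair_pre_digraph \<Rightarrow> nat \<Rightarrow> 'a set \<Rightarrow> bool" where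
  "blocking G k F \<longleftrightarrow> (\<forall>v\<in>F. card (neighbors G v - F) < k)"

lemma blocking_stays_vacant:
  assumes "blocking G k F" "\<And>v. v \<in> F \<Longrightarrow> finite (neighbors G v)" "F \<inter> A = {}"
  shows "F \<inter> occupied G k A n = {}"
proof (induction n)
  case (Suc n)
  have "\<not> k \<le> card (neighbors G v \<inter> occupied G k A n)" if v: "v \<in> F" for v
  proof -
    have "card (neighbors G v \<inter> occupied G k A n) \<le> card (neighbors G v - F)"
      using Suc assms(2)[OF v] by (intro card_mono) auto
    also have "\<dots> < k" using assms(1) v by (auto simp: blocking_def)
    finally show ?thesis by simp
  qed
  then show ?case using Suc by auto
qed (use assms in simp)

context locally_finite_rooted_tree
begin

text \<open>
  From such a vertex, a descending path with at most \<open>n\<close> vertices runs through vertices with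
  exactly \<open>k\<close> children to one with fewer than \<open>k\<close>. On the path, every vertex has fewer than \<open>k\<close>
  children off it.
\<close>

primrec near_deficit :: "nat \<Rightarrow> nat \<Rightarrow> 'a set" where
  "near_deficit k 0 = {}"
| "near_deficit k (Suc n) = {x \<in> pverts T. card (children T r x) < k \<or>
     card (children T r x) = k \<and> children T r x \<inter> near_deficit k n \<noteq> {}}"

lemma near_deficit_mono: "m \<le> n \<Longrightarrow> near_deficit k m \<subseteq> near_deficit k n"
proof -
  have "near_deficit k n \<subseteq> near_deficit k (Suc n)" for n by (induction n) auto
  then show "m \<le> n \<Longrightarrow> near_deficit k m \<subseteq> near_deficit k n" by (rule lift_Suc_mono_le)
qed

text \<open>
  All but at most \<open>k - 2\<close> children of such a vertex head a path of the above kind, so the vertex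
  and these paths form a fort: apart from the other children, the vertex has only its parent as
  a neighbor outside. The bound \<open>2 * k\<close> on the number of children bounds the number of paths,
  hence the size of the fort.
\<close>

definition fort_top :: "nat \<Rightarrow> nat \<Rightarrow> 'a set" where
  "fort_top k N = {x \<in> pverts T. card (children T r x) < 2 * k \<and>
     Suc (card (children T r x - near_deficit k N)) < k}"

text \<open>
  The only vertex whose parent lies outside is the top \<open>x\<close>, so for \<open>x\<close> only the children are
  counted; the parent is put into the set later. The depth range makes it possible to separate
  forts.
\<close>

definition is_path_fort :: "nat \<Rightarrow> nat \<Rightarrow> 'a \<Rightarrow> 'a set \<Rightarrow> bool" where
  "is_path_fort k n x F \<longleftrightarrow> x \<in> F \<and> F \<subseteq> pverts T \<and> finite F \<and> card F \<le> n \<and>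
     (\<forall>v\<in>F. depth T r x \<le> depth T r v \<and> depth T r v < depth T r x + n) \<and>
     card (children T r x - F) < k \<and> (\<forall>v\<in>F - {x}. card (neighbors T v - F) < k)"

lemma near_deficit_imp_path_fort:
  assumes "x \<in> near_deficit k n"
  shows "\<exists>F. is_path_fort k n x F"
  using assms
proof (induction n arbitrary: x)
  case (Suc n)
  show ?case
  proof (cases "card (children T r x) < k")
    case True
    have "card (children T r x - {x}) \<le> card (children T r x)"
      using finite_children by (intro card_mono) auto
    then show ?thesis using True Suc.prems by (intro exI[of _ "{x}"]) (auto simp: is_path_fort_def)
  next
    case False
    then obtain y where y: "y \<in> children T r x" "y \<in> near_deficit k n"
      and cx: "card (children T r x) = k" and xv: "x \<in> pverts T"
      using Suc.prems by auto
    obtain F where F: "is_path_fort k n y F"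
      using Suc.IH[OF y(2)] by blast
    have dy: "depth T r y = Suc (depth T r x)" using y by (simp add: children_def)
    have "children T r x - insert x F \<subset> children T r x" using y F by (auto simp: is_path_fort_def)
    then have top: "card (children T r x - insert x F) < k"
      using psubset_card_mono finite_children cx by metis
    have rest: "card (neighbors T v - insert x F) < k" if v: "v \<in> F" for v
    proof (cases "v = y")
      case True
      have "card (neighbors T v - insert x F) \<le> card (children T r y - F)"
        using neighbors_child[OF y(1)] finite_children True by (intro card_mono) auto
      then show ?thesis using F by (simp add: is_path_fort_def)
    next
      case False
      have "card (neighbors T v - insert x F) \<le> card (neighbors T v - F)"
        using finite_neighbors by (intro card_mono) auto
      also have "\<dots> < k" using F v False by (simp add: is_path_fort_def)
      finally show ?thesis .
    qed
    have "card (insert x F) \<le> Suc n" using F by (simp add: card_insert_if is_path_fort_def)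
    moreover have "depth T r x \<le> depth T r v \<and> depth T r v < depth T r x + Suc n"
      if "v \<in> insert x F" for v
      using that F dy by (fastforce simp: is_path_fort_def)
    ultimately show ?thesis
      using F top rest xv by (intro exI[of _ "insert x F"]) (auto simp: is_path_fort_def)
  qed
qed simp

lemma card_neighbors_minus_children:
  assumes x: "x \<in> pverts T"
  shows "card (neighbors T x - children T r x) \<le> 1"
proof -
  obtain u where "neighbors T x \<subseteq> insert u (children T r x)"
    using neighbors_root neighbors_child has_parent[OF x] by blast
  then have "neighbors T x - children T r x \<subseteq> {u}" by auto
  then show ?thesis using card_mono[of "{u}"] by fastforce
qed

definition is_fort_below :: "nat \<Rightarrow> nat \<Rightarrow> 'a \<Rightarrow> 'a set \<Rightarrow> bool" where
  "is_fort_below k N x F \<longleftrightarrow> F \<subseteq> pverts T \<and> finite F \<and> F \<noteq> {} \<and> card F \<le> Suc (2 * k * N) \<and>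
     (\<forall>v\<in>F. depth T r x \<le> depth T r v \<and> depth T r v \<le> depth T r x + N) \<and> blocking T k F"

lemma fort_top_imp_fort_below:
  assumes "x \<in> fort_top k N"
  shows "\<exists>F. is_fort_below k N x F"
proof -
  let ?C = "children T r x"
  let ?Y = "?C \<inter> near_deficit k N"
  have x: "x \<in> pverts T" "card ?C < 2 * k" "Suc (card (?C - near_deficit k N)) < k"
    using assms by (auto simp: fort_top_def)
  have "\<forall>y\<in>?Y. \<exists>F. is_path_fort k N y F" using near_deficit_imp_path_fort by blast
  from bchoice[OF this] obtain P where P: "\<And>y. y \<in> ?Y \<Longrightarrow> is_path_fort k N y (P y)" by blast
  define F where "F = insert x (\<Union>y\<in>?Y. P y)"
  have fY: "finite ?Y" using finite_children by simp
  have finF: "finite F" using fY P by (auto simp: F_def is_path_fort_def)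
  have "card F \<le> Suc (card (\<Union>y\<in>?Y. P y))"
    unfolding F_def by (simp add: card_insert_le_m1 card_insert_if finF)
  also have "card (\<Union>y\<in>?Y. P y) \<le> (\<Sum>y\<in>?Y. card (P y))"
    using fY by (rule card_UN_le)
  also have "\<dots> \<le> (\<Sum>y\<in>?Y. N)" using P by (intro sum_mono) (auto simp: is_path_fort_def)
  also have "\<dots> \<le> 2 * k * N"
  proof -
    have "card ?Y \<le> card ?C" using finite_children by (intro card_mono) auto
    then have "card ?Y \<le> 2 * k" using x(2) by linarith
    then show ?thesis by simp
  qed
  finally have card: "card F \<le> Suc (2 * k * N)" by simp
  have "card (neighbors T v - F) < k" if v: "v \<in> F" for v
  proof -
    consider "v = x" | y where "y \<in> ?Y" "v = y" | y where "y \<in> ?Y" "v \<in> P y" "v \<noteq> y"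
      using v unfolding F_def by blast
    then show ?thesis
    proof cases
      case 1
      have "?Y \<subseteq> F" using P by (auto simp: F_def is_path_fort_def)
      then have "neighbors T x - F \<subseteq> (?C - near_deficit k N) \<union> (neighbors T x - ?C)" by blast
      then have "card (neighbors T x - F) \<le> card ((?C - near_deficit k N) \<union> (neighbors T x - ?C))"
        using finite_children finite_neighbors by (intro card_mono) auto
      also have "\<dots> \<le> card (?C - near_deficit k N) + card (neighbors T x - ?C)" by (rule card_Un_le)
      also have "\<dots> < k" using card_neighbors_minus_children[OF x(1)] x(3) by linarith
      finally show ?thesis using 1 by simp
    next
      case 2
      have "neighbors T v - F \<subseteq> children T r y - P y"
        using neighbors_child[of y x] 2 by (auto simp: F_def)
      then have "card (neighbors T v - F) \<le> card (children T r y - P y)"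
        using finite_children by (intro card_mono) auto
      also have "\<dots> < k" using P[OF 2(1)] by (simp add: is_path_fort_def)
      finally show ?thesis .
    next
      case 3
      have "card (neighbors T v - F) \<le> card (neighbors T v - P y)"
        using finite_neighbors 3 by (intro card_mono) (auto simp: F_def)
      also have "\<dots> < k" using P[OF 3(1)] 3 by (simp add: is_path_fort_def)
      finally show ?thesis .
    qed
  qed
  then have "blocking T k F" by (simp add: blocking_def)
  moreover have "depth T r x \<le> depth T r v \<and> depth T r v \<le> depth T r x + N" if "v \<in> F" for v
  proof (cases "v = x")
    case False
    then obtain y where y: "y \<in> ?Y" "v \<in> P y" using \<open>v \<in> F\<close> by (auto simp: F_def)
    have "depth T r y \<le> depth T r v" "depth T r v < depth T r y + N"
      using P[OF y(1)] y(2) by (auto simp: is_path_fort_def)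
    moreover have "depth T r y = Suc (depth T r x)" using y by (simp add: children_def)
    ultimately show ?thesis by simp
  qed simp
  moreover have "F \<subseteq> pverts T" using P x(1) by (auto simp: F_def is_path_fort_def)
  moreover have "F \<noteq> {}" by (simp add: F_def)
  ultimately show ?thesis
    using card finF unfolding is_fort_below_def by blast
qed

text \<open>
  The fort below a top reaches at most \<open>N\<close> levels further down, and infinitely many tops occur
  at arbitrarily great depths; tops chosen more than \<open>N\<close> levels apart have disjoint forts.
\<close>

lemma infinite_fort_tops_imp_disjoint_forts:
  assumes inf: "infinite (fort_top k N)"
  obtains F :: "nat \<Rightarrow> 'a set" and x :: "nat \<Rightarrow> 'a"
  where "\<And>i. is_fort_below k N (x i) (F i)" "disjoint_family F"
proof -
  have sub: "fort_top k N \<subseteq> pverts T" by (auto simp: fort_top_def)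
  have "\<exists>x. \<forall>n. (x n \<in> fort_top k N) \<and> depth T r (x n) + N < depth T r (x (Suc n))"
  proof (rule dependent_nat_choice)
    show "\<exists>x. x \<in> fort_top k N" using inf by (metis all_not_in_conv finite.emptyI)
    show "\<exists>y. y \<in> fort_top k N \<and> depth T r x + N < depth T r y" for x
      using infinite_imp_unbounded_depth[OF inf sub, of "Suc (depth T r x + N)"]
      by (auto simp: Suc_le_eq)
  qed
  then obtain x where x: "\<And>n. x n \<in> fort_top k N" "\<And>n. depth T r (x n) + N < depth T r (x (Suc n))"
    by blast
  have gap: "depth T r (x i) + N < depth T r (x j)" if "i < j" for i j
    using that
  proof (induction j)
    case (Suc j)
    then show ?case using x(2)[of j] by (cases "i = j") (auto simp: less_Suc_eq)
  qed simp
  obtain F where F: "\<And>i. is_fort_below k N (x i) (F i)"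
    using fort_top_imp_fort_below[OF x(1)] by metis
  have disj: "F i \<inter> F j = {}" if "i < j" for i j
  proof (rule equals0I)
    fix v assume "v \<in> F i \<inter> F j"
    then have "depth T r v \<le> depth T r (x i) + N" "depth T r (x j) \<le> depth T r v"
      using F by (auto simp: is_fort_below_def)
    then show False using gap[OF that] by simp
  qed
  have "disjoint_family F"
    unfolding disjoint_family_on_def
  proof (intro ballI impI)
    fix i j :: nat assume "i \<noteq> j"
    then show "F i \<inter> F j = {}" using disj[of i j] disj[of j i] by (cases i j rule: linorder_cases) auto
  qed
  with F show thesis by (rule that)
qed

end

section \<open>Random configurations\<close>

lemma indep_vars_PiM_coordinates:
  assumes "I \<noteq> {}" and "\<And>i. prob_space (M i)"
  shows "prob_space.indep_vars (PiM I M) M (\<lambda>i \<omega>. \<omega> i) I"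
proof -
  interpret product_prob_space M I
    using assms(2) by (intro product_prob_spaceI)
  have "distr (PiM I M) (PiM I M) (\<lambda>\<omega>. \<lambda>i\<in>I. \<omega> i) = distr (PiM I M) (PiM I M) (\<lambda>\<omega>. \<omega>)"
    by (intro distr_cong) (auto simp: space_PiM PiE_def extensional_restrict)
  also have "\<dots> = PiM I M" by (rule distr_id)
  also have "\<dots> = PiM I (\<lambda>i. distr (PiM I M) (M i) (\<lambda>\<omega>. \<omega> i))"
    by (intro PiM_cong) (auto simp: PiM_component)
  finally show ?thesis
    using assms(1) by (subst indep_vars_iff_distr_eq_PiM') auto
qed

text \<open>
  Disjoint sets of coordinates are independent, and each set is entirely vacant with probability
  at least \<open>(1 - p) ^ M\<close>.
\<close>

lemma prob_no_vacant_set_le: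
  fixes F :: "nat \<Rightarrow> 'a set" and p :: real
  assumes p: "0 \<le> p" "p \<le> 1"
    and F: "\<And>i. finite (F i)" "\<And>i. F i \<subseteq> V" "\<And>i. card (F i) \<le> M" "disjoint_family F"
    and V: "V \<noteq> {}"
  defines "P \<equiv> \<Pi>\<^sub>M v \<in> V. measure_pmf (bernoulli_pmf p)"
  shows "{\<omega> \<in> space P. \<forall>i<n. \<exists>v\<in>F i. \<omega> v} \<in> sets P"
    and "measure P {\<omega> \<in> space P. \<forall>i<n. \<exists>v\<in>F i. \<omega> v} \<le> (1 - (1 - p) ^ M) ^ n"
proof -
  let ?B = "\<lambda>_::'a. measure_pmf (bernoulli_pmf p)"
  interpret product_prob_space ?B V
    by unfold_locales
  interpret Pr: prob_space P
    unfolding P_def by (rule prob_space_PiM) (rule prob_space_measure_pmf)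
  define vac where "vac i = (\<Pi>\<^sub>E v\<in>F i. {False})" for i
  define X :: "nat \<Rightarrow> ('a \<Rightarrow> bool) \<Rightarrow> 'a \<Rightarrow> bool" where "X i = (\<lambda>\<omega>. restrict \<omega> (F i))" for i
  have vac: "vac i \<in> sets (PiM (F i) ?B)" for i
    unfolding vac_def using F by (intro sets_PiM_I_finite) auto
  have ind: "Pr.indep_vars (\<lambda>i. PiM (F i) ?B) X UNIV"
    unfolding X_def P_def
    using indep_vars_PiM_coordinates[OF V, of ?B] F
    by (intro indep_vars_restrict) (auto simp: prob_space_measure_pmf)
  have Xm: "X i \<in> P \<rightarrow>\<^sub>M PiM (F i) ?B" for i
    using ind unfolding Pr.indep_vars_def by auto
  define A where "A i = X i -` (space (PiM (F i) ?B) - vac i) \<inter> space P" for i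
  have A_sets: "A i \<in> sets P" for i
    unfolding A_def using vac Xm by (intro measurable_sets[OF Xm]) auto
  have vac_iff: "X i \<omega> \<in> vac i \<longleftrightarrow> (\<forall>v\<in>F i. \<not> \<omega> v)" for i \<omega>
    unfolding vac_def X_def by (subst PiE_iff) auto
  have A_eq: "A i = {\<omega> \<in> space P. \<exists>v\<in>F i. \<omega> v}" for i
  proof -
    have "\<omega> \<in> A i \<longleftrightarrow> \<omega> \<in> space P \<and> (\<exists>v\<in>F i. \<omega> v)" for \<omega>
    proof (cases "\<omega> \<in> space P")
      case True
      have "X i \<omega> \<in> space (PiM (F i) ?B)" by (rule measurable_space[OF Xm True])
      then have "\<omega> \<in> A i \<longleftrightarrow> X i \<omega> \<notin> vac i"
        unfolding A_def using True by blast
      then show ?thesis unfolding vac_iff using True by simp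
    next
      case False
      then show ?thesis unfolding A_def by blast
    qed
    then show ?thesis by blast
  qed
  \<comment> \<open>The intersection with the whole space takes care of \<open>n = 0\<close>,
    where the inner intersection is \<open>UNIV\<close>.\<close>
  have event: "{\<omega> \<in> space P. \<forall>i<n. \<exists>v\<in>F i. \<omega> v} = space P \<inter> (\<Inter>i<n. A i)"
    unfolding A_eq by blast
  show "{\<omega> \<in> space P. \<forall>i<n. \<exists>v\<in>F i. \<omega> v} \<in> sets P"
  proof (cases "n = 0")
    case False
    have "(\<Inter>i<n. A i) \<in> sets P" using A_sets False by (intro sets.finite_INT) auto
    then show ?thesis unfolding event by (rule sets.Int[OF sets.top])
  qed (use sets.top in simp)
  have pA: "measure P (A i) \<le> 1 - (1 - p) ^ M" for i
  proof -
    have "X i -` vac i \<inter> space P = prod_emb V ?B (F i) (vac i)"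
      by (simp add: prod_emb_def X_def P_def space_PiM)
    also have "measure P \<dots> = (\<Prod>v\<in>F i. measure (?B v) {False})"
      unfolding P_def vac_def using F by (intro measure_PiM_emb) auto
    also have "\<dots> = (1 - p) ^ card (F i)"
      using p by (simp add: measure_pmf_single)
    also have "\<dots> \<ge> (1 - p) ^ M"
      using p F by (intro power_decreasing) auto
    finally have "(1 - p) ^ M \<le> measure P (X i -` vac i \<inter> space P)" .
    moreover have "A i = space P - (X i -` vac i \<inter> space P)"
      unfolding A_eq set_eq_iff Diff_iff Int_iff vimage_eq vac_iff mem_Collect_eq by blast
    ultimately show ?thesis
      using Pr.prob_compl[of "X i -` vac i \<inter> space P"] measurable_sets[OF Xm vac] by simp
  qed
  have "measure P (space P \<inter> (\<Inter>i<n. A i)) = (\<Prod>i<n. measure P (A i))"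
  proof (cases "n = 0")
    case False
    have "measure P (\<Inter>i<n. A i) = (\<Prod>i<n. measure P (A i))"
      unfolding A_def by (rule Pr.indep_varsD[OF ind]) (use False vac in \<open>simp_all add: sets.compl_sets lessThan_empty_iff\<close>)
    moreover have "space P \<inter> (\<Inter>i<n. A i) = (\<Inter>i<n. A i)"
      unfolding A_eq using False by blast
    ultimately show ?thesis by simp
  qed (simp add: Pr.prob_space)
  also have "\<dots> \<le> (\<Prod>i<n. 1 - (1 - p) ^ M)"
    using pA by (intro prod_mono) auto
  finally show "measure P {\<omega> \<in> space P. \<forall>i<n. \<exists>v\<in>F i. \<omega> v} \<le> (1 - (1 - p) ^ M) ^ n"
    unfolding event by simp
qed

lemma prob_no_vacant_set_eq_0:
  fixes F :: "nat \<Rightarrow> 'a set" and p :: real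
  assumes p: "0 \<le> p" "p < 1"
    and F: "\<And>i. finite (F i)" "\<And>i. F i \<subseteq> V" "\<And>i. card (F i) \<le> M" "disjoint_family F"
    and V: "V \<noteq> {}"
  defines "P \<equiv> \<Pi>\<^sub>M v \<in> V. measure_pmf (bernoulli_pmf p)"
  assumes E: "\<And>\<omega> i. \<omega> \<in> E \<Longrightarrow> \<exists>v\<in>F i. \<omega> v" "E \<subseteq> space P"
  shows "measure P E = 0"
proof -
  interpret Pr: prob_space P
    unfolding P_def by (rule prob_space_PiM) (rule prob_space_measure_pmf)
  have "measure P E \<le> (1 - (1 - p) ^ M) ^ n" for n
  proof -
    note no_vacant = prob_no_vacant_set_le[OF p(1) less_imp_le[OF p(2)] F V, of n, folded P_def]
    have "measure P E \<le> measure P {\<omega> \<in> space P. \<forall>i<n. \<exists>v\<in>F i. \<omega> v}"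
      using E by (intro Pr.finite_measure_mono[OF _ no_vacant(1)]) blast
    also note no_vacant(2)
    finally show ?thesis .
  qed
  moreover have "(\<lambda>n. (1 - (1 - p) ^ M) ^ n) \<longlonglongrightarrow> 0"
    using p by (intro LIMSEQ_power_zero) (auto simp: power_le_one)
  ultimately have "measure P E \<le> 0"
    by (intro LIMSEQ_le_const) auto
  then show ?thesis by (simp add: measure_le_0_iff)
qed

text \<open>
  At \<open>p = 1\<close> almost surely everything is occupied from the start. Most of the proof shows that
  complete occupation is an event at all: by local finiteness, being occupied at time \<open>Suc n\<close> is
  a finite combination of events about time \<open>n\<close>.
\<close>

lemma prob_complete_occupation_eq_1:
  assumes V: "countable (pverts G)" "\<And>v. finite (neighbors G v)" "\<And>v. neighbors G v \<subseteq> pverts G"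
  shows "measure (config_measure G 1) {\<omega> \<in> space (config_measure G 1).
            complete_occupation G k {v \<in> pverts G. \<omega> v}} = 1"
proof -
  let ?P = "config_measure G 1"
  interpret Pr: prob_space ?P
    unfolding config_measure_def by (rule prob_space_PiM) (rule prob_space_measure_pmf)
  have [measurable]: "{\<omega> \<in> space ?P. v \<in> occupied G k {v \<in> pverts G. \<omega> v} n} \<in> sets ?P"
    if "v \<in> pverts G" for v n
    using that
  proof (induction n arbitrary: v)
    case 0
    have [measurable]: "(\<lambda>\<omega>. \<omega> v) \<in> ?P \<rightarrow>\<^sub>M measure_pmf (bernoulli_pmf 1)"
      unfolding config_measure_def using 0 by simp
    have "{\<omega> \<in> space ?P. v \<in> occupied G k {v \<in> pverts G. \<omega> v} 0} = (\<lambda>\<omega>. \<omega> v) -` {True} \<inter> space ?P"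
      using 0 by auto
    then show ?case by simp
  next
    case (Suc n)
    let ?O = "\<lambda>\<omega>. occupied G k {v \<in> pverts G. \<omega> v} n"
    have "{\<omega> \<in> space ?P. k \<le> card (neighbors G v \<inter> ?O \<omega>)} =
        (\<Union>S \<in> {S \<in> Pow (neighbors G v). k \<le> card S}. {\<omega> \<in> space ?P. \<forall>w\<in>S. w \<in> ?O \<omega>})"
    proof (intro equalityI subsetI)
      fix \<omega> assume "\<omega> \<in> {\<omega> \<in> space ?P. k \<le> card (neighbors G v \<inter> ?O \<omega>)}"
      then show "\<omega> \<in> (\<Union>S \<in> {S \<in> Pow (neighbors G v). k \<le> card S}. {\<omega> \<in> space ?P. \<forall>w\<in>S. w \<in> ?O \<omega>})"
        by (intro UN_I[of "neighbors G v \<inter> ?O \<omega>"]) auto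
    next
      fix \<omega> assume "\<omega> \<in> (\<Union>S \<in> {S \<in> Pow (neighbors G v). k \<le> card S}. {\<omega> \<in> space ?P. \<forall>w\<in>S. w \<in> ?O \<omega>})"
      then obtain S where S: "S \<subseteq> neighbors G v" "k \<le> card S" "\<omega> \<in> space ?P" "S \<subseteq> ?O \<omega>" by auto
      then have "card S \<le> card (neighbors G v \<inter> ?O \<omega>)" using V(2) by (intro card_mono) auto
      then show "\<omega> \<in> {\<omega> \<in> space ?P. k \<le> card (neighbors G v \<inter> ?O \<omega>)}" using S by auto
    qed
    also have "\<dots> \<in> sets ?P"
    proof (intro sets.finite_UN)
      show "finite {S \<in> Pow (neighbors G v). k \<le> card S}" using V(2) by simp
      fix S assume "S \<in> {S \<in> Pow (neighbors G v). k \<le> card S}"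
      then have "S \<subseteq> pverts G" "finite S" using V finite_subset by blast+
      then show "{\<omega> \<in> space ?P. \<forall>w\<in>S. w \<in> ?O \<omega>} \<in> sets ?P"
        using Suc.IH by (intro sets.sets_Collect_finite_All) auto
    qed
    finally have "{\<omega> \<in> space ?P. v \<in> ?O \<omega>} \<union> {\<omega> \<in> space ?P. k \<le> card (neighbors G v \<inter> ?O \<omega>)} \<in> sets ?P"
      using Suc by auto
    then show ?case using Suc.prems by (auto simp: Collect_disj_eq Int_Un_distrib Collect_conj_eq)
  qed
  have event: "{\<omega> \<in> space ?P. complete_occupation G k {v \<in> pverts G. \<omega> v}} \<in> sets ?P"
    unfolding complete_occupation_def using V(1)
    by (intro sets.sets_Collect_countable_All' sets.sets_Collect_countable_Ex) auto
  have "AE \<omega> in ?P. \<forall>v\<in>pverts G. \<omega> v"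
    unfolding AE_ball_countable[OF V(1)]
  proof
    fix v assume v: "v \<in> pverts G"
    have "AE b in measure_pmf (bernoulli_pmf 1). b"
    proof (rule AE_pmfI)
      show b if "b \<in> set_pmf (bernoulli_pmf 1)" for b
        using that by (cases b) (simp_all add: set_pmf_iff)
    qed
    then show "AE \<omega> in ?P. \<omega> v"
      unfolding config_measure_def using v
      by (intro AE_PiM_component prob_space_measure_pmf) auto
  qed
  then have "AE \<omega> in ?P. complete_occupation G k {v \<in> pverts G. \<omega> v}"
    by eventually_elim (auto simp: complete_occupation_def intro!: exI[of _ 0])
  then show ?thesis using event Pr.prob_eq_1[OF event] by auto
qed

section \<open>Forts, flows and complete occupation\<close>

context locally_finite_rooted_tree
begin

text \<open>
  The proportion \<open>s x\<close> of those \<open>i\<close> from 1 to \<open>N\<close> for which \<open>x\<close> heads a path with at most \<open>i\<close>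
  vertices to a vertex with fewer than \<open>k\<close> children (a deficit) measures how close that deficit
  is. The function \<open>f = 1 - s / 2\<close> is \<open>1 / 2\<close> at the deficits and increases to 1 in small steps
  of \<open>1 / (2 * N)\<close> upwards along these paths. It is subharmonic at every vertex \<open>x\<close> that is not
  a fort top: either \<open>x\<close> has at least \<open>2 * k\<close> children, or at least \<open>k - 1\<close> of its children have
  the maximal value 1. With \<open>k - 1\<close> children, \<open>f x = 1 / 2\<close> compensates for the missing child,
  as \<open>k \<ge> 2\<close>; with exactly \<open>k\<close> children, at most one of them is below 1, and \<open>f x\<close> exceeds its
  value by at most one step, which the gap between \<open>lam\<close> and \<open>k\<close> absorbs; with more than \<open>k\<close>
  children, two values of at least \<open>1 / 2\<close> replace the missing 1.
\<close>

lemma admits_flow_of_finite_fort_tops: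
  assumes inf: "infinite (pverts T)"
    and k: "2 \<le> k"
    and lam: "1 \<le> lam"
    and N: "0 < N" "1 / real N \<le> 2 * (real k - lam)"
    and fin: "finite (fort_top k N)"
  shows "admits_flow T r lam"
proof -
  define s where "s x = real (card {i \<in> {1..N}. x \<in> near_deficit k i}) / real N" for x
  define f where "f x = 1 - s x / 2" for x
  have "lam < real k" using N by (smt (verit) divide_pos_pos of_nat_0_less_iff)
  have s: "0 \<le> s x" "s x \<le> 1" for x
  proof -
    have "card {i \<in> {1..N}. x \<in> near_deficit k i} \<le> card {1..N}" by (intro card_mono) auto
    then show "s x \<le> 1" using N by (simp add: s_def)
  qed (simp add: s_def)
  have s_0: "s y = 0" if "y \<notin> near_deficit k N" for y
  proof -
    have "{i \<in> {1..N}. y \<in> near_deficit k i} = {}"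
      using that near_deficit_mono[of _ N k] by auto
    then show ?thesis unfolding s_def by (metis card.empty div_0 of_nat_0)
  qed
  have s_1: "s x = 1" if "x \<in> pverts T" "card (children T r x) < k" for x
  proof -
    have "x \<in> near_deficit k i" if "1 \<le> i" for i
      using that \<open>x \<in> pverts T\<close> \<open>card (children T r x) < k\<close> by (cases i) auto
    then have "{i \<in> {1..N}. x \<in> near_deficit k i} = {1..N}" by auto
    then show ?thesis using N by (simp add: s_def)
  qed
  have s_step: "s y - 1 / real N \<le> s x"
    if "x \<in> pverts T" "card (children T r x) = k" "y \<in> children T r x" for x y
  proof -
    let ?I = "\<lambda>x. {i \<in> {1..N}. x \<in> near_deficit k i}"
    \<comment> \<open>A path from \<open>y\<close> becomes a path from \<open>x\<close> with one more vertex; only \<open>i = N\<close> is lost.\<close>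
    have "Suc ` (?I y - {N}) \<subseteq> ?I x" using that by auto
    then have "card (Suc ` (?I y - {N})) \<le> card (?I x)" by (intro card_mono) auto
    then have "card (?I y - {N}) \<le> card (?I x)" by (simp add: card_image)
    moreover have "card (?I y) - 1 \<le> card (?I y - {N})"
      using diff_card_le_card_Diff[of "{N}" "?I y"] by simp
    ultimately have "real (card (?I y)) - 1 \<le> real (card (?I x))" by linarith
    then have "(real (card (?I y)) - 1) / real N \<le> real (card (?I x)) / real N"
      by (rule divide_right_mono) simp
    then show ?thesis unfolding s_def diff_divide_distrib .
  qed
  have f_bounds: "0 < f x" "f x \<le> 1" for x
    using s[of x] by (simp_all add: f_def)
  obtain L where L: "\<And>x. x \<in> fort_top k N \<Longrightarrow> depth T r x < L"
    using fin finite_nat_set_iff_bounded[of "depth T r ` fort_top k N"] by auto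
  obtain z where z: "z \<in> pverts T" "depth T r z = L"
    using level_nonempty[OF inf] by blast
  show ?thesis
  proof (rule admits_flow_of_eventually_subharmonic[where f = f and L = L and z = z])
    show "lam * f x \<le> (\<Sum>y\<in>children T r x. f y)" if x: "x \<in> pverts T" "L \<le> depth T r x" for x
    proof -
      let ?A = "children T r x - near_deficit k N" and ?B = "children T r x \<inter> near_deficit k N"
      have "(\<Sum>y\<in>children T r x. f y) = (\<Sum>y\<in>?A. f y) + (\<Sum>y\<in>?B. f y)"
        using finite_children by (metis add.commute sum.Int_Diff)
      also have "(\<Sum>y\<in>?A. f y) = card ?A" using s_0 by (simp add: f_def)
      finally have sum_eq: "(\<Sum>y\<in>children T r x. f y) = card ?A + (\<Sum>y\<in>?B. f y)" .
      have "(\<Sum>y\<in>?B. 1 / 2) \<le> (\<Sum>y\<in>?B. f y)" using s by (intro sum_mono) (simp add: f_def)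
      then have sum_ge: "real (card ?A) + real (card ?B) / 2 \<le> (\<Sum>y\<in>children T r x. f y)"
        unfolding sum_eq by simp
      have card_eq: "card (children T r x) = card ?A + card ?B"
        using finite_children by (metis add.commute card_Int_Diff)
      have trivial: "lam * f x \<le> real k"
      proof -
        have "lam * f x \<le> lam * 1" using s[of x] lam by (intro mult_left_mono) (auto simp: f_def)
        then show ?thesis using \<open>lam < real k\<close> by simp
      qed
      have "x \<notin> fort_top k N" using L x by force
      then consider "2 * k \<le> card (children T r x)"
        | "k \<le> Suc (card ?A)" "card (children T r x) < k"
        | "k \<le> Suc (card ?A)" "card (children T r x) = k"
        | "k \<le> Suc (card ?A)" "k < card (children T r x)"
        unfolding fort_top_def using x by fastforce
      then show ?thesis
      proof cases
        case 1
        then have "real k \<le> real (card ?A) + real (card ?B) / 2" using card_eq by linarith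
        then show ?thesis using trivial sum_ge by linarith
      next
        case 2
        have "f x = 1 / 2" using s_1 x 2 by (simp add: f_def)
        then have "lam * f x = lam / 2" by (simp only: times_divide_eq_right mult_1_right)
        moreover have "real k \<le> 2 * real (card ?A)" using 2 k by linarith
        ultimately show ?thesis using sum_ge \<open>lam < real k\<close> by linarith
      next
        case 4
        then have "real k \<le> real (card ?A) + real (card ?B) / 2" using card_eq by linarith
        then show ?thesis using trivial sum_ge by linarith
      next
        case 3
        then consider "card ?B = 0" "card ?A = k" | "card ?B = 1" "Suc (card ?A) = k"
          using card_eq by linarith
        then show ?thesis
        proof cases
          case 1
          then show ?thesis using trivial sum_ge by simp
        next
          case 2
          then obtain y where y: "?B = {y}" by (auto simp: card_1_singleton_iff)
          then have sum: "(\<Sum>y\<in>children T r x. f y) = real k - s y / 2"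
            using sum_eq 2 by (simp add: f_def)
          have "y \<in> children T r x" using y by blast
          then have "s y - 1 / real N \<le> s x" using s_step x(1) 3(2) by blast
          then have "s y - 2 * (real k - lam) \<le> s x" using N(2) by linarith
          also have "\<dots> \<le> lam * s x" using s[of x] lam by (simp add: mult_right_mono[of 1 lam "s x", simplified])
          finally show ?thesis unfolding sum by (simp add: f_def[of x] algebra_simps)
        qed
      qed
    qed
  qed (use f_bounds z lam in \<open>auto intro: less_imp_le\<close>)
qed

text \<open>
  Otherwise there would be a flow for a \<open>lam\<close> strictly between the branching number and \<open>k\<close>.
\<close>

lemma infinite_fort_tops:
  assumes inf: "infinite (pverts T)" and k: "0 < k" and br: "branching_number T r < ereal (real k)"
  shows "\<exists>N. infinite (fort_top k N)"
proof -
  have flow_le: "ereal lam \<le> branching_number T r" if "1 \<le> lam" "admits_flow T r lam" for lam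
    unfolding branching_number_def using that by (intro Sup_upper) auto
  obtain lam where br_lam: "branching_number T r < ereal lam" "lam < real k"
    using ereal_dense2[OF br] by auto
  have lam: "1 < lam" "lam < real k"
    using order_le_less_trans[OF flow_le[OF order_refl admits_flow_1[OF inf]] br_lam(1)] br_lam(2) by simp_all
  then have k2: "2 \<le> k" by linarith
  obtain n where n: "1 / real (Suc n) < 2 * (real k - lam)"
    using nat_approx_posE[of "2 * (real k - lam)"] lam by auto
  have "infinite (fort_top k (Suc n))"
  proof
    assume "finite (fort_top k (Suc n))"
    then have "admits_flow T r lam"
      using inf k2 lam n by (intro admits_flow_of_finite_fort_tops[of k lam "Suc n"]) auto
    then have "ereal lam \<le> branching_number T r" using flow_le lam by simp
    then show False using br_lam(1) by simp
  qed
  then show ?thesis by blast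
qed

lemma prob_complete_occupation_eq_0:
  assumes inf: "infinite (fort_top k N)" and p: "0 \<le> p" "p < 1"
  shows "measure (config_measure T p) {\<omega> \<in> space (config_measure T p).
            complete_occupation T k {v \<in> pverts T. \<omega> v}} = 0"
proof -
  obtain F :: "nat \<Rightarrow> 'a set" and x where F: "\<And>i. is_fort_below k N (x i) (F i)" "disjoint_family F"
    using infinite_fort_tops_imp_disjoint_forts[OF inf] by blast
  have hit: "\<exists>v\<in>F i. \<omega> v" if "complete_occupation T k {v \<in> pverts T. \<omega> v}" for \<omega> i
  proof (rule ccontr)
    assume "\<not> ?thesis"
    then have "F i \<inter> {v \<in> pverts T. \<omega> v} = {}" by auto
    moreover have "blocking T k (F i)" using F(1) by (simp add: is_fort_below_def)
    ultimately have "F i \<inter> occupied T k {v \<in> pverts T. \<omega> v} n = {}" for n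
      using finite_neighbors by (intro blocking_stays_vacant) auto
    moreover obtain v where "v \<in> F i" "v \<in> pverts T"
      using F(1)[of i] by (auto simp: is_fort_below_def)
    ultimately show False using that unfolding complete_occupation_def by blast
  qed
  show ?thesis
    unfolding config_measure_def
  proof (rule prob_no_vacant_set_eq_0[OF p])
    show "finite (F i)" "F i \<subseteq> pverts T" "card (F i) \<le> Suc (2 * k * N)" for i
      using F(1)[of i] by (auto simp: is_fort_below_def)
    show "disjoint_family F" by (rule F(2))
    show "pverts T \<noteq> {}" using root by auto
  qed (use hit in auto)
qed

end

theorem theorem1p1:
  fixes T :: "'a pair_pre_digraph" and r :: 'a and k :: nat
  assumes "undirected_tree T"
    and "infinite (pverts T)"
    and "locally_finite T"
    and "0 < k"
    and "r \<in> pverts T"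
    and "branching_number T r < ereal (real k)"
  shows "critical_probability T k = 1"
proof -
  interpret locally_finite_rooted_tree T r
    using assms by unfold_locales auto
  obtain N where N: "infinite (fort_top k N)"
    using infinite_fort_tops assms by blast
  have "{p \<in> {0..1}. 0 < measure (config_measure T p) {\<omega> \<in> space (config_measure T p).
            complete_occupation T k {v \<in> pverts T. \<omega> v}}} = {1}" (is "?S = _")
  proof (intro equalityI subsetI)
    fix p :: real assume p: "p \<in> ?S"
    then have "\<not> p < 1" using prob_complete_occupation_eq_0[OF N, of p] by auto
    then show "p \<in> {1}" using p by auto
  next
    have "measure (config_measure T 1) {\<omega> \<in> space (config_measure T 1).
            complete_occupation T k {v \<in> pverts T. \<omega> v}} = 1"
      using countable_verts finite_neighbors neighbors_in_verts
      by (intro prob_complete_occupation_eq_1) auto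
    then show "p \<in> ?S" if "p \<in> {1}" for p using that by simp
  qed
  then show ?thesis unfolding critical_probability_def by simp
qed

end
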